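(* Let $0<\gamma\le1$. There are positive constants $c_1,c_2$, depending only on $\gamma$, such that the following holds. Let $n\in\mathbb N$ and let $X$ and $Y$ be any $n$-dimensional $\gamma$-Banach spaces with normalised symmetric bases $\{x_i\}_{i=1}^n$ and $\{y_i\}_{i=1}^n$ respectively, and let $id:X\to Y$ be the natural embedding $id\left(\sum_{i=1}^n a_ix_i\right)=\sum_{i=1}^n a_iy_i$. Then for any integer $k\ge n$, $$c_1\,2^{-k/n}\,\frac{\varphi_Y(n)}{\varphi_X(n)}\le e_k(id:X\to Y)\le c_2\,2^{-k/n}\,\frac{\varphi_Y(n)}{\varphi_X(n)} .$$
   Context: All vector spaces are real. For $\gamma\in(0,1]$, a $\gamma$-norm on a vector space $X$ is a function $\|\cdot|X\|:X\to[0,\infty)$ that vanishes only at $0$, is absolutely homogeneous, and satisfies $\|x+y|X\|^\gamma\le\|x|X\|^\gamma+\|y|X\|^\gamma$ for all $x,y\in X$. A $\gamma$-Banach space is a vector space that is complete with respect to a given $\gamma$-norm. A basis $\{x_i\}_{i=1}^n$ of an $n$-dimensional $\gamma$-Banach space $X$ is symmetric if $\left\|\sum_{i=1}^n a_ix_i|X\right\|=\left\|\sum_{i=1}^n\varepsilon_ia_{\pi(i)}x_i|X\right\|$ for every permutation $\pi$ of $\{1,\dots,n\}$, all $\varepsilon_i\in\{\pm1\}$ and all $a_i\in\mathbb R$; it is normalised if $\|x_i|X\|=1$ for all $i$. The fundamental function is $\varphi_X(n)=\left\|\sum_{i=1}^n x_i|X\right\|$, and similarly $\varphi_Y(n)=\left\|\sum_{i=1}^n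 y_i|Y\right\|$. $B_X$ denotes the closed unit ball of $X$. For a bounded linear operator $T:X\to Y$ and $k\in\mathbb N=\{1,2,\dots\}$, the $k$-th (outer) entropy number $e_k(T)$ is the infimum of all $\varepsilon>0$ such that $T(B_X)$ can be covered by $2^{k-1}$ balls $y+\varepsilon B_Y$ ($y\in Y$) in $Y$ of radius $\varepsilon$. *)

theory Defs
  imports "HOL-Analysis.Analysis" "HOL-Analysis.Finite_Function_Topology"
begin

text \<open>
  A \<open>\<gamma>\<close>-Banach space is given by a carrier \<open>X\<close>, a linear subspace of an ambient type of class
  \<^class>\<open>real_vector\<close>, and a function \<open>N\<close> of which only the values on \<open>X\<close> matter. The carrier is
  a set rather than a type so that its dimension can be quantified over.
\<close>

definition gamma_norm_on :: "real \<Rightarrow> 'a::real_vector set \<Rightarrow> ('a \<Rightarrow> real) \<Rightarrow> bool" where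
  "gamma_norm_on \<gamma> X N \<longleftrightarrow>
     (\<forall>v\<in>X. 0 \<le> N v) \<and>
     (\<forall>v\<in>X. N v = 0 \<longleftrightarrow> v = 0) \<and>
     (\<forall>a. \<forall>v\<in>X. N (a *\<^sub>R v) = \<bar>a\<bar> * N v) \<and>
     (\<forall>v\<in>X. \<forall>w\<in>X. N (v + w) powr \<gamma> \<le> N v powr \<gamma> + N w powr \<gamma>)"

definition complete_wrt :: "'a::real_vector set \<Rightarrow> ('a \<Rightarrow> real) \<Rightarrow> bool" where
  "complete_wrt X N \<longleftrightarrow>
     (\<forall>s :: nat \<Rightarrow> 'a. range s \<subseteq> X \<longrightarrow>
        (\<forall>\<epsilon>>0. \<exists>m0. \<forall>m\<ge>m0. \<forall>l\<ge>m0. N (s m - s l) < \<epsilon>) \<longrightarrow>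
        (\<exists>v\<in>X. (\<lambda>m. N (s m - v)) \<longlonglongrightarrow> 0))"

definition gamma_banach :: "real \<Rightarrow> 'a::real_vector set \<Rightarrow> ('a \<Rightarrow> real) \<Rightarrow> bool" where
  "gamma_banach \<gamma> X N \<longleftrightarrow> subspace X \<and> gamma_norm_on \<gamma> X N \<and> complete_wrt X N"

definition is_basis :: "nat \<Rightarrow> 'a::real_vector set \<Rightarrow> (nat \<Rightarrow> 'a) \<Rightarrow> bool" where
  "is_basis n X x \<longleftrightarrow> inj_on x {1..n} \<and> independent (x ` {1..n}) \<and> span (x ` {1..n}) = X"

definition symmetric_basis ::
  "nat \<Rightarrow> 'a::real_vector set \<Rightarrow> ('a \<Rightarrow> real) \<Rightarrow> (nat \<Rightarrow> 'a) \<Rightarrow> bool" where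
  "symmetric_basis n X N x \<longleftrightarrow> is_basis n X x \<and>
     (\<forall>\<pi> \<epsilon> a. \<pi> permutes {1..n} \<longrightarrow> (\<forall>i\<in>{1..n}. \<epsilon> i \<in> {1, -1}) \<longrightarrow>
        N (\<Sum>i=1..n. a i *\<^sub>R x i) = N (\<Sum>i=1..n. (\<epsilon> i * a (\<pi> i)) *\<^sub>R x i))"

definition normalised :: "nat \<Rightarrow> ('a \<Rightarrow> real) \<Rightarrow> (nat \<Rightarrow> 'a) \<Rightarrow> bool" where
  "normalised n N x \<longleftrightarrow> (\<forall>i\<in>{1..n}. N (x i) = 1)"

definition fundamental :: "('a::real_vector \<Rightarrow> real) \<Rightarrow> (nat \<Rightarrow> 'a) \<Rightarrow> nat \<Rightarrow> real" where
  "fundamental N x n = N (\<Sum>i=1..n. x i)"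

definition unit_ball :: "'a set \<Rightarrow> ('a \<Rightarrow> real) \<Rightarrow> 'a set" where
  "unit_ball X N = {v\<in>X. N v \<le> 1}"

text \<open>The centres \<open>c i\<close> need not be distinct.\<close>

definition entropy_number ::
  "nat \<Rightarrow> 'a::real_vector set \<Rightarrow> ('a \<Rightarrow> real) \<Rightarrow> 'b::real_vector set \<Rightarrow> ('b \<Rightarrow> real)
     \<Rightarrow> ('a \<Rightarrow> 'b) \<Rightarrow> real" where
  "entropy_number k X N Y M T =
     Inf {\<epsilon>. \<epsilon> > 0 \<and> (\<exists>c :: nat \<Rightarrow> 'b. (\<forall>i < 2 ^ (k - 1). c i \<in> Y) \<and>
            T ` unit_ball X N \<subseteq> (\<Union>i < 2 ^ (k - 1). (\<lambda>v. c i + \<epsilon> *\<^sub>R v) ` unit_ball Y M))}"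

definition natural_embedding ::
  "nat \<Rightarrow> (nat \<Rightarrow> 'a::real_vector) \<Rightarrow> (nat \<Rightarrow> 'b::real_vector) \<Rightarrow> 'a \<Rightarrow> 'b" where
  "natural_embedding n x y v = (\<Sum>i=1..n. representation (x ` {1..n}) v (x i) *\<^sub>R y i)"

lemma natural_embedding_sum:
  assumes "is_basis n X x"
  shows "natural_embedding n x y (\<Sum>i=1..n. a i *\<^sub>R x i) = (\<Sum>i=1..n. a i *\<^sub>R y i)"
proof -
  let ?B = "x ` {1..n}"
  have ind: "independent ?B" and inj: "inj_on x {1..n}"
    using assms by (auto simp: is_basis_def)
  have sp: "a i *\<^sub>R x i \<in> span ?B" if "i \<in> {1..n}" for i
    using that by (intro span_scale span_base) auto
  have "representation ?B (\<Sum>i=1..n. a i *\<^sub>R x i) (x j) = a j" if j: "j \<in> {1..n}" for j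
  proof -
    have "representation ?B (\<Sum>i=1..n. a i *\<^sub>R x i) (x j)
            = (\<Sum>i=1..n. representation ?B (a i *\<^sub>R x i) (x j))"
      using real_vector.representation_sum[OF ind, of "{1..n}" "\<lambda>i. a i *\<^sub>R x i"] sp by simp
    also have "\<dots> = (\<Sum>i=1..n. if i = j then a i else 0)"
    proof (rule sum.cong)
      fix i assume i: "i \<in> {1..n}"
      then have xi: "x i \<in> ?B" by blast
      have "representation ?B (a i *\<^sub>R x i) (x j) = a i * (if x j = x i then 1 else 0)"
        unfolding real_vector.representation_scale[OF ind span_base[OF xi]]
          real_vector.representation_basis[OF ind xi] ..
      also have "\<dots> = (if i = j then a i else 0)"
        using inj_on_eq_iff[OF inj j i] by auto
      finally show "representation ?B (a i *\<^sub>R x i) (x j) = (if i = j then a i else 0)" .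
    qed simp
    finally show ?thesis using j by simp
  qed
  then show ?thesis by (simp add: natural_embedding_def)
qed

text \<open>
  The two-sided estimate with constants \<open>c1\<close>, \<open>c2\<close>, for all spaces of all dimensions \<open>n \<ge> 1\<close>
  inside the ambient types \<open>'a\<close> (for \<open>X\<close>) and \<open>'b\<close> (for \<open>Y\<close>).
\<close>

definition entropy_estimate ::
  "'a::real_vector itself \<Rightarrow> 'b::real_vector itself \<Rightarrow> real \<Rightarrow> real \<Rightarrow> real \<Rightarrow> bool" where
  "entropy_estimate TA TB \<gamma> c1 c2 \<longleftrightarrow>
     (\<forall>n (X :: 'a set) N x (Y :: 'b set) M y k.
        1 \<le> n \<longrightarrow>
        gamma_banach \<gamma> X N \<longrightarrow> dim X = n \<longrightarrow> symmetric_basis n X N x \<longrightarrow> normalised n N x \<longrightarrow>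
        gamma_banach \<gamma> Y M \<longrightarrow> dim Y = n \<longrightarrow> symmetric_basis n Y M y \<longrightarrow> normalised n M y \<longrightarrow>
        n \<le> k \<longrightarrow>
        c1 * 2 powr (- (real k / real n)) * (fundamental M y n / fundamental N x n)
          \<le> entropy_number k X N Y M (natural_embedding n x y) \<and>
        entropy_number k X N Y M (natural_embedding n x y)
          \<le> c2 * 2 powr (- (real k / real n)) * (fundamental M y n / fundamental N x n))"

text \<open>
  A bare statement \<open>\<exists>c1 c2. entropy_estimate TYPE('a) TYPE('b) \<gamma> c1 c2\<close> would let the constants
  depend on the types \<open>'a\<close> and \<open>'b\<close>, since HOL cannot quantify over types under \<open>\<exists>\<close>. The type
  below contains subspaces of every finite dimension, so each finite-dimensional
  \<open>\<gamma>\<close>-Banach space has an isometric copy in it: constants are chosen for this one type, and are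
  then required to be valid for all pairs of types.
\<close>

type_synonym universal = "nat \<Rightarrow>\<^sub>0 real"

end

theory Submission
  imports Defs
begin

text \<open>
  Volumes are replaced by the counting of integer points. In coefficients, let \<open>F\<close> and \<open>H\<close> be
  the \<open>\<gamma>\<close>-norms of \<open>X\<close> and \<open>Y\<close>. Symmetry and \<open>\<gamma>\<close>-subadditivity make \<open>F\<close> monotone in
  \<open>\<bar>a\<^sub>i\<bar>\<close> up to a constant, and force \<open>#{i. \<bar>a\<^sub>i\<bar> \<ge> t} \<le> C n (F a / (t \<phi>(n)))\<^sup>\<gamma>\<close>. Hence an
  integer vector \<open>z\<close> with \<open>F z \<le> c \<phi>(n)\<close>, \<open>c\<close> small, satisfies
  \<open>(\<Prod>i. 1 + \<bar>z\<^sub>i\<bar>)\<^sup>3\<^sup>2 \<le> 2\<^sup>n\<close>, and there are at most \<open>2\<^sup>n\<^sup>/\<^sup>2\<close> such vectors.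

  Upper bound: rounding towards a lattice of mesh \<open>\<delta> \<sim> 1 / \<phi>\<^sub>X(n)\<close> covers \<open>B\<^sub>X\<close> by at most
  \<open>2\<^sup>n\<^sup>-\<^sup>1\<close> cubes of radius \<open>\<delta>\<close>; each is split into \<open>m\<^sup>n\<close> cubes with
  \<open>m = \<lfloor>2\<^sup>k\<^sup>/\<^sup>n / 2\<rfloor>\<close>, and a cube of radius \<open>\<delta> / m\<close> lies in a ball of radius
  \<open>C \<phi>\<^sub>Y(n) \<delta> / m\<close> of \<open>Y\<close>. Lower bound: \<open>B\<^sub>X\<close> contains a cube of radius \<open>\<sim> 1 / \<phi>\<^sub>X(n)\<close>, in
  which we take a grid of \<open>m\<^sup>n\<close> points with \<open>m = \<lceil>2 \<cdot> 2\<^sup>k\<^sup>/\<^sup>n\<rceil>\<close>; a ball of \<open>Y\<close> with too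
  small a radius contains at most \<open>2\<^sup>n\<^sup>/\<^sup>2\<close> of them, since differences of grid points are
  multiples of the integer vectors counted above.
\<close>

subsection \<open>Symmetric functionals on coefficient vectors\<close>

text \<open>The inequality \<open>K \<le> (G a + K) / 2 powr \<gamma>\<close> found in
  \<open>solid\<close>, solved for \<open>K\<close>, reads
  \<open>K \<le> solidity_const \<gamma> * G a\<close>.\<close>

definition solidity_const :: "real \<Rightarrow> real" where
  "solidity_const \<gamma> = 1 / (2 powr \<gamma> - 1)"

text \<open>Chosen so that the dyadic level sets of an integer vector \<open>z\<close> with
  \<open>G z \<le> lattice_const \<gamma> * G 1\<close> have at most \<open>n / 32\<close> elements altogether.\<close>

definition lattice_const :: "real \<Rightarrow> real" where
  "lattice_const \<gamma> = (1 - 2 powr - \<gamma>) / (64 * (solidity_const \<gamma>)\<^sup>2)"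

lemma solidity_const_pos: "0 < \<gamma> \<Longrightarrow> 0 < solidity_const \<gamma>"
  unfolding solidity_const_def by simp

lemma lattice_const_pos: "0 < \<gamma> \<Longrightarrow> 0 < lattice_const \<gamma>"
  unfolding lattice_const_def using solidity_const_pos[of \<gamma>] by (simp add: powr_minus field_simps)

text \<open>What remains of a space with a normalised symmetric basis once vectors are replaced by
  their coefficients. Coefficient vectors are functions on all of \<open>nat\<close>; by
  \<open>cong\<close> only the entries with index in \<open>{1..n}\<close> count.\<close>

locale symmetric_functional =
  fixes \<gamma> :: real and n :: nat and F :: "(nat \<Rightarrow> real) \<Rightarrow> real"
  assumes gamma: "0 < \<gamma>" "\<gamma> \<le> 1" and n_pos: "1 \<le> n"
    and cong: "\<And>a b. (\<And>i. i \<in> {1..n} \<Longrightarrow> a i = b i) \<Longrightarrow> F a = F b"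
    and nonneg: "\<And>a. 0 \<le> F a"
    and scale: "\<And>c a. F (\<lambda>i. c * a i) = \<bar>c\<bar> * F a"
    and triangle: "\<And>a b. F (\<lambda>i. a i + b i) powr \<gamma> \<le> F a powr \<gamma> + F b powr \<gamma>"
    and symmetric: "\<And>\<pi> \<epsilon> a. \<pi> permutes {1..n} \<Longrightarrow> (\<And>i. i \<in> {1..n} \<Longrightarrow> \<epsilon> i \<in> {1, -1}) \<Longrightarrow>
       F a = F (\<lambda>i. \<epsilon> i * a (\<pi> i))"
    and unit: "\<And>i. i \<in> {1..n} \<Longrightarrow> F (indicator {i}) = 1"
begin

text \<open>The power \<open>\<gamma>\<close> turns the quasi-norm into a subadditive functional, so
  most estimates are made for \<open>G\<close>, and roots enter only through the radii.\<close>

abbreviation G :: "(nat \<Rightarrow> real) \<Rightarrow> real" where "G a \<equiv> F a powr \<gamma>"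

abbreviation one :: "nat \<Rightarrow> real" where "one \<equiv> \<lambda>_. 1"

lemma G_scale: "G (\<lambda>i. c * a i) = \<bar>c\<bar> powr \<gamma> * G a"
  by (simp add: scale powr_mult nonneg)

lemma G_diff: "G (\<lambda>i. a i - b i) \<le> G a + G b"
  using triangle[of a "\<lambda>i. - 1 * b i"] G_scale[of "-1" b] by simp

text \<open>Coordinates are added one at a time; a multiple \<open>a i\<close> of a unit vector
  contributes exactly \<open>\<bar>a i\<bar> powr \<gamma>\<close>.\<close>

lemma G_sum_le: "G a \<le> (\<Sum>i=1..n. \<bar>a i\<bar> powr \<gamma>)"
proof -
  have "G (\<lambda>i. indicator S i * a i) \<le> (\<Sum>i\<in>S. \<bar>a i\<bar> powr \<gamma>)" if "S \<subseteq> {1..n}" for S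
    using finite_subset[OF that finite_atLeastAtMost] that
  proof (induction S rule: finite_induct)
    case empty
    show ?case using scale[of 0] by simp
  next
    case (insert x S)
    have "G (\<lambda>i. indicator (insert x S) i * a i)
        = G (\<lambda>i. a x * indicator {x} i + indicator S i * a i)"
      using insert by (intro arg_cong[where f="\<lambda>u. u powr \<gamma>"] cong) (auto simp: indicator_def)
    also have "\<dots> \<le> G (\<lambda>i. a x * indicator {x} i) + G (\<lambda>i. indicator S i * a i)"
      by (rule triangle)
    also have "G (\<lambda>i. a x * indicator {x} i) = \<bar>a x\<bar> powr \<gamma>"
      using insert unit[of x] by (simp add: G_scale)
    finally show ?case using insert by simp
  qed
  from this[of "{1..n}"] cong[of a "\<lambda>i. indicator {1..n} i * a i"] show ?thesis by simp
qed

text \<open>With \<open>K\<close> the supremum of \<open>G b\<close> over all \<open>b\<close> dominated by \<open>a\<close>, each such \<open>b\<close> is half the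
  sum of a sign change of \<open>a\<close> and another dominated vector, so that
  \<open>K \<le> 2\<^sup>-\<^sup>\<gamma> (G a + K)\<close>.\<close>

lemma solid:
  assumes "\<And>i. i \<in> {1..n} \<Longrightarrow> \<bar>b i\<bar> \<le> \<bar>a i\<bar>"
  shows "G b \<le> solidity_const \<gamma> * G a"
proof -
  define B where "B = {b. \<forall>i\<in>{1..n}. \<bar>b i\<bar> \<le> \<bar>a i\<bar>}"
  define K where "K = Sup (G ` B)"
  \<comment> \<open>The supremum must be known to be finite before the inequality bounding
    \<open>K\<close> by itself can be solved for \<open>K\<close>.\<close>
  have bdd: "bdd_above (G ` B)"
  proof (rule bdd_aboveI2)
    fix b assume "b \<in> B"
    then show "G b \<le> (\<Sum>i=1..n. \<bar>a i\<bar> powr \<gamma>)"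
      using gamma by (intro order.trans[OF G_sum_le] sum_mono powr_mono2) (auto simp: B_def)
  qed
  have step: "G b \<le> (G a + K) / 2 powr \<gamma>" if b: "b \<in> B" for b
  proof -
    \<comment> \<open>The sign makes \<open>s i * a i\<close> point in the direction of
      \<open>b i\<close>, so that \<open>2 * b i - s i * a i\<close> stays between
      \<open>- \<bar>a i\<bar>\<close> and \<open>\<bar>a i\<bar>\<close>.\<close>
    define s :: "nat \<Rightarrow> real" where "s i = (if b i * a i \<ge> 0 then 1 else -1)" for i
    define b' where "b' i = 2 * b i - s i * a i" for i
    have "\<bar>b' i\<bar> \<le> \<bar>a i\<bar>" if "i \<in> {1..n}" for i
    proof -
      have "\<bar>b i\<bar> \<le> \<bar>a i\<bar>" using b that by (auto simp: B_def)
      then show ?thesis unfolding b'_def s_def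
        by (auto simp: zero_le_mult_iff abs_if split: if_splits)
    qed
    then have "G b' \<le> K" unfolding K_def
      by (intro cSUP_upper[OF _ bdd]) (auto simp: B_def)
    moreover have "G (\<lambda>i. s i * a i) = G a"
      using symmetric[of id s a] permutes_id by (auto simp: s_def)
    moreover have "b = (\<lambda>i. (1/2) * (s i * a i + b' i))" by (auto simp: b'_def)
    then have "G b = (1/2) powr \<gamma> * G (\<lambda>i. s i * a i + b' i)"
      using G_scale[of "1/2" "\<lambda>i. s i * a i + b' i"] by simp
    moreover have "G (\<lambda>i. s i * a i + b' i) \<le> G (\<lambda>i. s i * a i) + G b'" by (rule triangle)
    ultimately show ?thesis by (simp add: powr_divide divide_right_mono)
  qed
  have bB: "b \<in> B" using assms by (auto simp: B_def)
  have "K \<le> (G a + K) / 2 powr \<gamma>"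
    unfolding K_def by (rule cSUP_least) (use bB step in \<open>auto simp: K_def\<close>)
  then have "K \<le> solidity_const \<gamma> * G a"
    using gamma by (simp add: solidity_const_def field_simps)
  moreover have "G b \<le> K" unfolding K_def by (intro cSUP_upper[OF bB bdd])
  ultimately show ?thesis by simp
qed

text \<open>A unit vector has norm 1 and is dominated by \<open>one\<close>, so solidity keeps
  \<open>F one\<close> away from 0.\<close>

lemma F_one_pos: "0 < F one"
proof -
  have "G (indicator {1}) \<le> solidity_const \<gamma> * G one"
    by (rule solid) (auto simp: indicator_def)
  then have "F one \<noteq> 0" using unit[of 1] n_pos by auto
  then show ?thesis using nonneg[of one] by simp
qed

section \<open>Norms of indicators and sizes of level sets\<close>

lemma F_indicator_card:
  assumes "S \<subseteq> {1..n}" "T \<subseteq> {1..n}" "card S = card T"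
  shows "F (indicator S) = F (indicator T)"
proof -
  have fin: "finite S" "finite T" using assms finite_subset by blast+
  obtain f where f: "bij_betw f T S"
    using finite_same_card_bij[of T S] fin assms by auto
  have "card ({1..n} - T) = card ({1..n} - S)"
    using assms fin by (simp add: card_Diff_subset)
  then obtain g where g: "bij_betw g ({1..n} - T) ({1..n} - S)"
    using finite_same_card_bij[of "{1..n} - T" "{1..n} - S"] by auto
  \<comment> \<open>Symmetry asks for a permutation of the whole of \<open>{1..n}\<close>, so the
    bijection from \<open>T\<close> to \<open>S\<close> is glued with one between the
    complements.\<close>
  define \<pi> where "\<pi> i = (if i \<in> T then f i else if i \<in> {1..n} then g i else i)" for i
  have "bij_betw \<pi> T S" using f by (rule bij_betw_cong[THEN iffD1, rotated]) (auto simp: \<pi>_def)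
  moreover have "bij_betw \<pi> ({1..n} - T) ({1..n} - S)"
    using g by (rule bij_betw_cong[THEN iffD1, rotated]) (auto simp: \<pi>_def)
  ultimately have "bij_betw \<pi> (T \<union> ({1..n} - T)) (S \<union> ({1..n} - S))"
    by (rule bij_betw_combine) auto
  then have "bij_betw \<pi> {1..n} {1..n}" using assms by (simp add: Un_absorb1)
  then have perm: "\<pi> permutes {1..n}"
    by (rule bij_imp_permutes) (use assms in \<open>auto simp: \<pi>_def\<close>)
  have "F (indicator S) = F (\<lambda>i. 1 * indicator S (\<pi> i))"
    by (rule symmetric[OF perm]) auto
  also have "\<dots> = F (indicator T)"
  proof (rule cong)
    fix i assume i: "i \<in> {1..n}"
    show "1 * indicator S (\<pi> i) = (indicator T i :: real)"
    proof (cases "i \<in> T")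
      case True
      then show ?thesis using bij_betwE[OF f] by (simp add: \<pi>_def)
    next
      case False
      then show ?thesis using bij_betwE[OF g] i by (simp add: \<pi>_def)
    qed
  qed
  finally show ?thesis .
qed

text \<open>Blocks of at most \<open>card S\<close> elements are removed from \<open>T\<close> one
  after the other. A permutation moves each block into \<open>S\<close>, where solidity bounds
  it.\<close>

lemma G_indicator_cover:
  assumes S: "S \<subseteq> {1..n}"
  shows "T \<subseteq> {1..n} \<Longrightarrow> card T \<le> q * card S \<Longrightarrow>
    G (indicator T) \<le> real q * (solidity_const \<gamma> * G (indicator S))"
proof (induction q arbitrary: T)
  case 0
  then have "T = {}" using finite_subset by fastforce
  then have "indicator T = (\<lambda>i. 0 * one i)" by auto
  then show ?case by (simp only: scale) simp
next
  case (Suc q)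
  have fin: "finite T" "finite S" using Suc S finite_subset by blast+
  \<comment> \<open>The minimum allows for a last block smaller than \<open>S\<close>;
    \<open>V\<close> is a part of \<open>S\<close> of the same size as the block
    \<open>U\<close>.\<close>
  obtain U where U: "U \<subseteq> T" "card U = min (card S) (card T)"
    using obtain_subset_with_card_n[of "min (card S) (card T)" T] by auto
  obtain V where V: "V \<subseteq> S" "card V = min (card S) (card T)"
    using obtain_subset_with_card_n[of "min (card S) (card T)" S] by auto
  have "card (T - U) \<le> q * card S"
    using Suc.prems U fin by (auto simp: card_Diff_subset finite_subset min_def)
  then have 1: "G (indicator (T - U)) \<le> real q * (solidity_const \<gamma> * G (indicator S))"
    using Suc by (intro Suc.IH) auto
  have "F (indicator U) = F (indicator V)"
    using U V S Suc.prems by (intro F_indicator_card) auto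
  then have 2: "G (indicator U) \<le> solidity_const \<gamma> * G (indicator S)"
    using V by (auto intro!: solid simp: indicator_def)
  have "indicator T = (\<lambda>i. indicator (T - U) i + indicator U i :: real)"
    using U by (auto simp: fun_eq_iff indicator_def)
  then have "G (indicator T) \<le> G (indicator (T - U)) + G (indicator U)"
    using triangle[of "indicator (T - U)" "indicator U"] by simp
  with 1 2 show ?case by (simp add: algebra_simps)
qed

text \<open>About \<open>n / card S\<close> blocks of the size of \<open>S\<close> make up
  \<open>{1..n}\<close>. Thus an indicator carries, up to a constant, at least its proportional
  share of \<open>G one\<close>.\<close>

lemma G_indicator_ge:
  assumes "S \<subseteq> {1..n}"
  shows "real (card S) * G one \<le> 2 * real n * solidity_const \<gamma> * G (indicator S)"
proof (cases "card S = 0")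
  case True
  then show ?thesis using solidity_const_pos[OF gamma(1)] by simp
next
  case False
  \<comment> \<open>Adding 1 rounds the quotient up; the price is
    \<open>card S * q \<le> n + card S \<le> 2 * n\<close>.\<close>
  define q where "q = n div card S + 1"
  have le: "card S \<le> n" using card_mono[OF _ assms] by simp
  have "n \<le> q * card S" unfolding q_def
    using dividend_less_div_times[of "card S" n] False by (simp add: algebra_simps)
  then have "G (indicator {1..n}) \<le> real q * (solidity_const \<gamma> * G (indicator S))"
    by (intro G_indicator_cover assms) auto
  moreover have "F (indicator {1..n}) = F one" by (rule cong) auto
  ultimately have "real (card S) * G one
      \<le> real (card S * q) * (solidity_const \<gamma> * G (indicator S))"
    by (simp add: mult_left_mono mult.assoc)
  also have "card S * q \<le> 2 * n"
    using add_mono[OF div_times_less_eq_dividend[of n "card S"] le]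
    by (simp add: q_def algebra_simps)
  then have "real (card S * q) * (solidity_const \<gamma> * G (indicator S))
      \<le> (2 * real n) * (solidity_const \<gamma> * G (indicator S))"
    using solidity_const_pos[OF gamma(1)] by (intro mult_right_mono) (simp_all flip: of_nat_mult)
  finally show ?thesis by (simp add: mult.assoc)
qed

text \<open>The vector \<open>t * indicator S\<close> is dominated by \<open>a\<close>, and
  \<open>G_indicator_ge\<close> bounds it from below in terms of \<open>card S\<close>. The factor
  \<open>1 - 2 powr - \<gamma>\<close> is carried along to cancel the geometric series that arises
  for \<open>t = 2 ^ j\<close>.\<close>

lemma level_set_card:
  assumes t: "0 < t" and S: "S \<subseteq> {1..n}" "\<And>i. i \<in> S \<Longrightarrow> t \<le> \<bar>a i\<bar>"
    and a: "G a \<le> lattice_const \<gamma> * G one"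
  shows "real (card S) * 32 \<le> real n * (1 - 2 powr - \<gamma>) * t powr - \<gamma>"
proof -
  let ?D = "solidity_const \<gamma>"
  have D: "0 < ?D" by (rule solidity_const_pos[OF gamma(1)])
  have "G (\<lambda>i. t * indicator S i) \<le> ?D * G a"
    using S t by (intro solid) (auto simp: indicator_def)
  then have "t powr \<gamma> * G (indicator S) \<le> ?D * (lattice_const \<gamma> * G one)"
    using t D order.trans[OF _ mult_left_mono[OF a, of ?D]] by (simp add: G_scale)
  then have "2 * real n * ?D * (t powr \<gamma> * G (indicator S))
      \<le> 2 * real n * ?D * (?D * (lattice_const \<gamma> * G one))"
    using D by (intro mult_left_mono) auto
  moreover have "t powr \<gamma> * (real (card S) * G one)
     \<le> t powr \<gamma> * (2 * real n * ?D * G (indicator S))"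
    by (intro mult_left_mono G_indicator_ge S) auto
  ultimately have "(real (card S) * t powr \<gamma>) * G one
      \<le> (2 * real n * ?D\<^sup>2 * lattice_const \<gamma>) * G one"
    by (simp add: algebra_simps power2_eq_square)
  then have "real (card S) * t powr \<gamma> \<le> 2 * real n * ?D\<^sup>2 * lattice_const \<gamma>"
    using F_one_pos by simp
  also have "\<dots> = real n * (1 - 2 powr - \<gamma>) / 32"
    using D by (simp add: lattice_const_def field_simps)
  finally have "real (card S) * 32 \<le> real n * (1 - 2 powr - \<gamma>) / t powr \<gamma>"
    using t by (subst pos_le_divide_eq) (simp_all add: mult_ac)
  then show ?thesis by (simp add: powr_minus divide_inverse)
qed

end

subsection \<open>Counting integer points\<close>

text \<open>Each term is compared with a telescoping one: of the eight factors
  \<open>real N + 2\<close>, six have product at least 64, and the other two are bounded below by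
  \<open>(real N + 1) * (real N + 2)\<close>.\<close>

lemma sum_inverse_power8_le:
  "(\<Sum>j=1..N. 1 / (1 + real j) ^ 8) \<le> (1 - 1 / (real N + 1)) / 64"
proof (induction N)
  case (Suc N)
  have "64 * ((real N + 1) * (real N + 2)) \<le> (real N + 2) ^ 6 * ((real N + 2) * (real N + 2))"
  proof (rule mult_mono)
    show "64 \<le> (real N + 2) ^ 6" using power_mono[of 2 "real N + 2" 6] by simp
  qed (auto intro!: mult_right_mono)
  then have "1 / (real N + 2) ^ 8 \<le> 1 / (64 * ((real N + 1) * (real N + 2)))"
    using power_add[of "real N + 2" 6 2]
    by (intro divide_left_mono) (simp_all add: power2_eq_square)
  also have "\<dots> = (1 / (real N + 1) - 1 / (real N + 2)) / 64"
    by (simp add: field_simps)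
  finally show ?case using Suc by (simp add: algebra_simps diff_divide_distrib)
qed simp

text \<open>Zero contributes 1 and each sign at most 1/64. The sum is used only through the fact
  that 33/32 is below the fourth root of 2.\<close>

lemma sum_int_inverse_power8_le:
  "(\<Sum>z\<in>{- int N..int N}. 1 / (1 + \<bar>real_of_int z\<bar>) ^ 8) \<le> 33 / 32"
proof -
  let ?h = "\<lambda>z :: int. 1 / (1 + \<bar>real_of_int z\<bar>) ^ 8"
  let ?P = "int ` {1..N}" and ?M = "(\<lambda>j. - int j) ` {1..N}"
  have "z \<in> insert 0 (?P \<union> ?M)" if z: "z \<in> {- int N..int N}" for z
  proof -
    consider "z = 0" | "z = int (nat z)" "nat z \<in> {1..N}" | "z = - int (nat (- z))" "nat (- z) \<in> {1..N}"
      using z by (cases "z = 0"; cases "0 < z") (auto simp: le_nat_iff nat_le_iff)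
    then show ?thesis by cases blast+
  qed
  then have "{- int N..int N} \<subseteq> insert 0 (?P \<union> ?M)" by (rule subsetI)
  then have "sum ?h {- int N..int N} \<le> sum ?h (insert 0 (?P \<union> ?M))"
    by (intro sum_mono2) simp_all
  also have "\<dots> = ?h 0 + sum ?h (?P \<union> ?M)"
    by (rule sum.insert) auto
  also have "sum ?h (?P \<union> ?M) = sum ?h ?P + sum ?h ?M"
    by (rule sum.union_disjoint) auto
  also have "?h 0 + \<dots> = 1 + 2 * (\<Sum>j=1..N. 1 / (1 + real j) ^ 8)"
    by (simp add: sum.reindex inj_on_def)
  also have "\<dots> \<le> 33 / 32"
  proof -
    have "(1 - 1 / (real N + 1)) / 64 \<le> 1 / 64" by simp
    then show ?thesis using sum_inverse_power8_le[of N] by linarith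
  qed
  finally show ?thesis .
qed

text \<open>Counting with weights: give \<open>z\<close> the weight \<open>1 / ?p z ^ 8\<close>. On
  \<open>Z\<close> it is at least \<open>2 powr (- n / 4)\<close>, while the total weight factors
  over the coordinates and is at most \<open>2 powr (n / 4)\<close>.\<close>

lemma card_int_vectors_prod_le:
  fixes n :: nat
  defines "Z \<equiv> {z \<in> {1..n} \<rightarrow>\<^sub>E (UNIV :: int set).
    (\<Prod>i=1..n. 1 + \<bar>real_of_int (z i)\<bar>) ^ 32 \<le> 2 ^ n}"
  shows "finite Z" and "real (card Z) \<le> sqrt 2 ^ n"
proof -
  let ?N = "2 ^ n :: nat" and ?p = "\<lambda>z. \<Prod>i=1..n. 1 + \<bar>real_of_int (z i)\<bar>"
  let ?box = "{1..n} \<rightarrow>\<^sub>E {- int ?N..int ?N}"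
  have p1: "1 \<le> ?p z" for z by (rule prod_ge_1) auto
  \<comment> \<open>One factor is at most the whole product, hence at most \<open>2 ^ n\<close>. The
    box makes the sum of weights finite.\<close>
  have "Z \<subseteq> ?box"
  proof
    fix z assume z: "z \<in> Z"
    show "z \<in> ?box"
    proof (rule PiE_I)
      fix i assume i: "i \<in> {1..n}"
      have "1 + \<bar>real_of_int (z i)\<bar> \<le> (1 + \<bar>real_of_int (z i)\<bar>) * (\<Prod>j\<in>{1..n} - {i}. 1 + \<bar>real_of_int (z j)\<bar>)"
        by (intro mult_le_cancel_left1[THEN iffD2]) (auto intro!: prod_ge_1)
      also have "\<dots> = ?p z" using i by (simp add: prod.remove)
      also have "\<dots> \<le> ?p z ^ 32" using p1 by (rule self_le_power) simp
      also have "\<dots> \<le> 2 ^ n" using z by (auto simp: Z_def)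
      finally have "real_of_int \<bar>z i\<bar> \<le> real_of_int (int ?N)" by simp
      then have "\<bar>z i\<bar> \<le> int ?N" by (simp only: of_int_le_iff)
      then show "z i \<in> {- int ?N..int ?N}" by auto
    qed (use z in \<open>auto simp: Z_def\<close>)
  qed
  moreover have fin: "finite ?box" by (intro finite_PiE) auto
  ultimately show "finite Z" by (rule finite_subset)
  have p8: "?p z ^ 8 \<le> sqrt (sqrt 2) ^ n" if "z \<in> Z" for z
  proof -
    have "(?p z ^ 8) ^ 4 \<le> 2 ^ n" using that by (auto simp: Z_def simp flip: power_mult)
    also have "(2::real) ^ n = (sqrt (sqrt 2) ^ n) ^ 4"
    proof -
      have "sqrt (sqrt 2) ^ 4 = 2" using power_mult[of "sqrt (sqrt 2)" 2 2] by simp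
      then show ?thesis by (metis power_mult mult.commute)
    qed
    finally show ?thesis by (rule power_le_imp_le_base[of _ 3, simplified]) auto
  qed
  have "1 \<le> sqrt (sqrt 2) ^ n * (1 / ?p z ^ 8)" if "z \<in> Z" for z
  proof -
    have "0 < ?p z ^ 8" using p1[of z] by (intro zero_less_power) linarith
    then show ?thesis using p8[OF that] by (simp add: le_divide_eq_1_pos)
  qed
  then have "real (card Z) \<le> (\<Sum>z\<in>Z. sqrt (sqrt 2) ^ n * (1 / ?p z ^ 8))"
    using sum_mono[of Z "\<lambda>_. 1 :: real"] by simp
  also have "\<dots> \<le> (\<Sum>z\<in>?box. sqrt (sqrt 2) ^ n * (1 / ?p z ^ 8))"
    using p1 \<open>Z \<subseteq> ?box\<close> fin by (intro sum_mono2) (auto intro!: divide_nonneg_nonneg zero_le_power prod_nonneg)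
  also have "\<dots> = sqrt (sqrt 2) ^ n * (\<Sum>z\<in>?box. \<Prod>i=1..n. 1 / (1 + \<bar>real_of_int (z i)\<bar>) ^ 8)"
    by (simp add: sum_distrib_left prod_dividef prod_power_distrib)
  also have "(\<Sum>z\<in>?box. \<Prod>i=1..n. 1 / (1 + \<bar>real_of_int (z i)\<bar>) ^ 8)
      = (\<Prod>i=1..n. \<Sum>z\<in>{- int ?N..int ?N}. 1 / (1 + \<bar>real_of_int z\<bar>) ^ 8)"
    by (rule prod_sum_PiE[symmetric]) auto
  also have "\<dots> \<le> (\<Prod>i=1..n. sqrt (sqrt 2))"
  proof (rule prod_mono)
    have "(33 / 32 :: real) \<le> sqrt (sqrt 2)"
      by (intro real_le_rsqrt) (simp add: power2_eq_square)
    then show "0 \<le> (\<Sum>z\<in>{- int ?N..int ?N}. 1 / (1 + \<bar>real_of_int z\<bar>) ^ 8) \<and>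
       (\<Sum>z\<in>{- int ?N..int ?N}. 1 / (1 + \<bar>real_of_int z\<bar>) ^ 8) \<le> sqrt (sqrt 2)" for i
      using sum_int_inverse_power8_le[of ?N] by (auto intro!: sum_nonneg)
  qed
  finally show "real (card Z) \<le> sqrt 2 ^ n"
    by (simp flip: power_mult_distrib)
qed

text \<open>The number of \<open>j\<close> with \<open>2 ^ j \<le> \<bar>u\<bar>\<close> is the
  binary length of \<open>\<bar>u\<bar>\<close>, so 2 to that power exceeds
  \<open>\<bar>u\<bar>\<close>. Double counting then exchanges coordinates and dyadic
  levels.\<close>

lemma prod_one_plus_abs_le:
  fixes z :: "nat \<Rightarrow> int"
  assumes "finite I" "\<And>i. i \<in> I \<Longrightarrow> \<bar>z i\<bar> < 2 ^ J"
  shows "(\<Prod>i\<in>I. 1 + \<bar>real_of_int (z i)\<bar>) \<le> 2 ^ (\<Sum>j<J. card {i \<in> I. 2 ^ j \<le> \<bar>z i\<bar>})"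
proof -
  have digits: "1 + \<bar>u\<bar> \<le> 2 ^ card {j \<in> {..<J}. 2 ^ j \<le> \<bar>u\<bar>}" if "\<bar>u\<bar> < 2 ^ J" for u :: int
    using that
  proof (induction J)
    case (Suc J)
    show ?case
    proof (cases "\<bar>u\<bar> < 2 ^ J")
      case True
      then have "{j \<in> {..<Suc J}. 2 ^ j \<le> \<bar>u\<bar>} = {j \<in> {..<J}. 2 ^ j \<le> \<bar>u\<bar>}"
        by (auto simp: less_Suc_eq)
      then show ?thesis using Suc.IH True by simp
    next
      case False
      have "(2::int) ^ j \<le> \<bar>u\<bar>" if "j < Suc J" for j
        using False order.trans[OF power_increasing[of j J "2::int"]] that by simp
      then have "{j \<in> {..<Suc J}. 2 ^ j \<le> \<bar>u\<bar>} = {..<Suc J}" by auto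
      then show ?thesis using Suc.prems by simp
    qed
  qed simp
  have "(\<Prod>i\<in>I. 1 + \<bar>real_of_int (z i)\<bar>) \<le> (\<Prod>i\<in>I. 2 ^ card {j \<in> {..<J}. 2 ^ j \<le> \<bar>z i\<bar>})"
  proof (rule prod_mono, safe)
    fix i assume "i \<in> I"
    then have "real_of_int (1 + \<bar>z i\<bar>) \<le> real_of_int (2 ^ card {j \<in> {..<J}. 2 ^ j \<le> \<bar>z i\<bar>})"
      unfolding of_int_le_iff by (intro digits assms)
    then show "1 + \<bar>real_of_int (z i)\<bar> \<le> 2 ^ card {j \<in> {..<J}. 2 ^ j \<le> \<bar>z i\<bar>}" by simp
  qed simp
  also have "\<dots> = 2 ^ (\<Sum>i\<in>I. card {j \<in> {..<J}. 2 ^ j \<le> \<bar>z i\<bar>})"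
    by (simp add: power_sum)
  also have "(\<Sum>i\<in>I. card {j \<in> {..<J}. 2 ^ j \<le> \<bar>z i\<bar>}) = (\<Sum>j<J. card {i \<in> I. 2 ^ j \<le> \<bar>z i\<bar>})"
    using assms(1) by (intro sum_multicount_gen) auto
  finally show ?thesis .
qed

context symmetric_functional
begin

text \<open>Extensional functions are used so that each integer vector of length \<open>n\<close> is
  counted once.\<close>

definition lattice_points :: "(nat \<Rightarrow> int) set" where
  "lattice_points = {z \<in> {1..n} \<rightarrow>\<^sub>E UNIV. G (\<lambda>i. of_int (z i)) \<le> lattice_const \<gamma> * G one}"

lemma lattice_points_prod_le:
  assumes "z \<in> lattice_points"
  shows "(\<Prod>i=1..n. 1 + \<bar>real_of_int (z i)\<bar>) ^ 32 \<le> 2 ^ n"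
proof -
  \<comment> \<open>Any \<open>J\<close> with all entries below \<open>2 ^ J\<close> would do; the
    sum of the absolute values is a convenient one.\<close>
  define J where "J = nat (\<Sum>i=1..n. \<bar>z i\<bar>)"
  let ?m = "\<lambda>j. card {i \<in> {1..n}. 2 ^ j \<le> \<bar>z i\<bar>}" and ?r = "2 powr - \<gamma>"
  have r: "0 < ?r" "?r < 1" using gamma by (auto simp: powr_minus field_simps)
  have lt: "\<bar>z i\<bar> < 2 ^ J" if "i \<in> {1..n}" for i
  proof -
    have "\<bar>z i\<bar> \<le> (\<Sum>i=1..n. \<bar>z i\<bar>)" using that by (intro member_le_sum) auto
    also have "\<dots> = int J" by (simp add: J_def sum_nonneg)
    also have "\<dots> < 2 ^ J" using of_nat_less_two_power[of J, where 'a=int] by simp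
    finally show ?thesis .
  qed
  have "real (?m j) * 32 \<le> real n * (1 - ?r) * ?r ^ j" for j
  proof -
    have "real (?m j) * 32 \<le> real n * (1 - ?r) * (2 ^ j) powr - \<gamma>"
    proof (rule level_set_card)
      show "2 ^ j \<le> \<bar>real_of_int (z i)\<bar>" if "i \<in> {i \<in> {1..n}. 2 ^ j \<le> \<bar>z i\<bar>}" for i
        using that of_int_le_iff[of "2 ^ j" "\<bar>z i\<bar>", where 'a=real] by simp
    qed (use assms in \<open>auto simp: lattice_points_def\<close>)
    also have "(2 ^ j) powr - \<gamma> = ?r ^ j"
      by (simp add: powr_realpow[symmetric] powr_powr mult.commute)
    finally show ?thesis .
  qed
  then have "(\<Sum>j<J. real (?m j) * 32) \<le> (\<Sum>j<J. real n * (1 - ?r) * ?r ^ j)"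
    by (rule sum_mono)
  also have "\<dots> = real n * ((1 - ?r) * (\<Sum>j<J. ?r ^ j))"
    by (simp add: sum_distrib_left mult.assoc)
  \<comment> \<open>Here the factor built into \<open>lattice_const\<close> absorbs the geometric
    series over the dyadic levels.\<close>
  also have "(1 - ?r) * (\<Sum>j<J. ?r ^ j) = 1 - ?r ^ J"
    by (rule one_diff_power_eq[symmetric])
  also have "real n * (1 - ?r ^ J) \<le> real n" using r by (simp add: mult_left_le)
  finally have "real ((\<Sum>j<J. ?m j) * 32) \<le> real n" by (simp add: sum_distrib_right)
  then have le: "(\<Sum>j<J. ?m j) * 32 \<le> n" by (simp only: of_nat_le_iff)
  have "(\<Prod>i=1..n. 1 + \<bar>real_of_int (z i)\<bar>) ^ 32 \<le> (2 ^ (\<Sum>j<J. ?m j)) ^ 32"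
    by (intro power_mono prod_one_plus_abs_le lt prod_nonneg) auto
  also have "\<dots> = 2 ^ ((\<Sum>j<J. ?m j) * 32)" by (simp only: power_mult)
  also have "\<dots> \<le> 2 ^ n" using le by (intro power_increasing) auto
  finally show ?thesis .
qed

lemma finite_lattice_points: "finite lattice_points"
  and card_lattice_points: "real (card lattice_points) \<le> sqrt 2 ^ n"
proof -
  let ?Z = "{z \<in> {1..n} \<rightarrow>\<^sub>E (UNIV :: int set).
    (\<Prod>i=1..n. 1 + \<bar>real_of_int (z i)\<bar>) ^ 32 \<le> 2 ^ n}"
  have sub: "lattice_points \<subseteq> ?Z"
    using lattice_points_prod_le by (auto simp: lattice_points_def)
  show "finite lattice_points"
    using card_int_vectors_prod_le(1) by (rule finite_subset[OF sub])
  show "real (card lattice_points) \<le> sqrt 2 ^ n"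
    using card_mono[OF card_int_vectors_prod_le(1) sub] card_int_vectors_prod_le(2)[of n]
    by linarith
qed

end

subsection \<open>Covering numbers in coefficients\<close>

text \<open>The set whose infimum is the entropy number, with centres given by coefficients and
  balls by an inequality for the difference; see \<open>entropy_number_eq_Inf\<close>.\<close>

definition admissible_radii ::
  "nat \<Rightarrow> ((nat \<Rightarrow> real) \<Rightarrow> real) \<Rightarrow> ((nat \<Rightarrow> real) \<Rightarrow> real) \<Rightarrow> real set" where
  "admissible_radii k F H = {\<epsilon>. \<epsilon> > 0 \<and>
     (\<exists>c :: nat \<Rightarrow> nat \<Rightarrow> real. \<forall>a. F a \<le> 1 \<longrightarrow> (\<exists>i < 2 ^ (k - 1). H (\<lambda>j. a j - c i j) \<le> \<epsilon>))}"

lemma finite_subset_image_lessThan: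
  assumes "finite P" "card P \<le> m"
  shows "\<exists>c. P \<subseteq> c ` {..<m :: nat}"
proof -
  obtain c where "bij_betw c {0..<card P} P" using ex_bij_betw_nat_finite[OF assms(1)] by blast
  then have "P = c ` {0..<card P}" by (simp add: bij_betw_def)
  also have "\<dots> \<subseteq> c ` {..<m}" using assms(2) by (intro image_mono) auto
  finally show ?thesis by blast
qed

text \<open>The interval from \<open>- \<delta>\<close> to \<open>\<delta>\<close> is cut into
  \<open>m\<close> equal pieces of half-length \<open>\<delta> / m\<close>; the points subtracted
  from \<open>u\<close> are their midpoints.\<close>

lemma real_interval_subdivision:
  fixes u \<delta> :: real
  assumes "0 < m" "0 < \<delta>" "\<bar>u\<bar> \<le> \<delta>"
  shows "\<exists>j<m. \<bar>u - \<delta> * (2 * real j + 1 - real m) / real m\<bar> \<le> \<delta> / real m"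
proof -
  \<comment> \<open>The position of \<open>u\<close> after rescaling the interval to length
    \<open>m\<close>. The floor gives the piece, except that the right endpoint \<open>v = m\<close>
    is assigned to the last one.\<close>
  define v where "v = (u / \<delta> + 1) * real m / 2"
  define j where "j = (if v = real m then m - 1 else nat \<lfloor>v\<rfloor>)"
  have u: "-1 \<le> u / \<delta>" "u / \<delta> \<le> 1" using assms by (auto simp: field_simps abs_le_iff)
  then have v: "0 \<le> v" "v \<le> real m" unfolding v_def using assms by (auto intro!: mult_nonneg_nonneg)
  then have j: "j < m" "real j \<le> v" "v \<le> real j + 1"
    using assms(1) unfolding j_def by (auto simp: of_nat_diff) linarith+
  have "u - \<delta> * (2 * real j + 1 - real m) / real m = \<delta> / real m * (2 * (v - real j) - 1)"
    unfolding v_def using assms by (simp add: field_simps)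
  also have "\<bar>\<dots>\<bar> = \<delta> / real m * \<bar>2 * (v - real j) - 1\<bar>" using assms by (simp add: abs_mult)
  also have "\<dots> \<le> \<delta> / real m * 1" using j assms by (intro mult_left_mono) auto
  finally show ?thesis using j by auto
qed

text \<open>Rounding goes towards zero, not to the nearest multiple, so that the rounded vector is
  dominated by the given one and solidity applies.\<close>

lemma truncation_toward_zero:
  fixes u \<delta> :: real
  assumes "0 < \<delta>"
  obtains z :: int where "\<bar>\<delta> * of_int z\<bar> \<le> \<bar>u\<bar>" "\<bar>u - \<delta> * of_int z\<bar> \<le> \<delta>"
proof (cases "0 \<le> u")
  case True
  define z where "z = \<lfloor>u / \<delta>\<rfloor>"
  have "of_int z \<le> u / \<delta>" "u / \<delta> \<le> of_int z + 1"
    unfolding z_def by linarith+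
  moreover have "0 \<le> z" using True assms by (simp add: z_def)
  ultimately have "\<delta> * of_int z \<le> u" "u \<le> \<delta> * of_int z + \<delta>" "0 \<le> \<delta> * of_int z"
    using assms by (auto simp: field_simps)
  then show ?thesis by (intro that[of z]) auto
next
  case False
  define z where "z = \<lceil>u / \<delta>\<rceil>"
  have "u / \<delta> < 0" using False assms by (simp add: divide_neg_pos)
  then have "u / \<delta> \<le> of_int z" "of_int z \<le> u / \<delta> + 1" "z \<le> 0"
    unfolding z_def by linarith+
  then have "u \<le> \<delta> * of_int z" "\<delta> * of_int z \<le> u + \<delta>" "\<delta> * of_int z \<le> 0"
    using assms by (auto simp: field_simps mult_nonneg_nonpos)
  then show ?thesis using False by (intro that[of z]) auto
qed

text \<open>One factor \<open>solidity_const \<gamma>\<close> and the division by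
  \<open>lattice_const \<gamma>\<close> come from the mesh in \<open>X\<close>, the other factor
  from fitting a cube into a ball of \<open>Y\<close>. The 4 is the loss in
  \<open>m \<ge> 2 powr (k / n) / 4\<close>.\<close>

definition upper_const :: "real \<Rightarrow> real" where
  "upper_const \<gamma> = 4 * ((solidity_const \<gamma>)\<^sup>2 / lattice_const \<gamma>) powr (1 / \<gamma>)"

text \<open>The solidity constant comes from fitting a cube into the unit ball of \<open>X\<close>,
  the 2 from comparing two points of one ball of \<open>Y\<close>, and the 3 from
  \<open>m \<le> 3 * 2 powr (k / n)\<close>.\<close>

definition lower_const :: "real \<Rightarrow> real" where
  "lower_const \<gamma> = (lattice_const \<gamma> / (2 * solidity_const \<gamma>)) powr (1 / \<gamma>) / 3"

lemma (in symmetric_functional) le_iff_powr: "0 \<le> t \<Longrightarrow> F a \<le> t \<longleftrightarrow> G a \<le> t powr \<gamma>"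
  using gamma nonneg[of a] powr_mono2[of \<gamma> "F a" t] powr_less_mono2[of \<gamma> t "F a"]
  by (cases "F a \<le> t") auto

section \<open>The covering and packing bounds for two functionals\<close>

locale symmetric_functional_pair =
  F: symmetric_functional \<gamma> n F + H: symmetric_functional \<gamma> n H for \<gamma> n F H
begin

abbreviation one :: "nat \<Rightarrow> real" where "one \<equiv> \<lambda>_. 1"

lemma admissible_radius_upper:
  assumes k: "n \<le> k"
  defines "r \<equiv> upper_const \<gamma> * 2 powr - (real k / real n) * (H one / F one)"
  shows "\<exists>\<epsilon>\<in>admissible_radii k F H. \<epsilon> \<le> r"
proof -
  let ?D = "solidity_const \<gamma>" and ?A = "lattice_const \<gamma>"
  note gamma = F.gamma and n = F.n_pos
  have D: "0 < ?D" and A: "0 < ?A"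
    using solidity_const_pos lattice_const_pos gamma by auto
  have pos: "0 < F one" "0 < H one" by (rule F.F_one_pos H.F_one_pos)+
  \<comment> \<open>The mesh solves \<open>\<delta> powr \<gamma> * (?A * F.G one) = ?D\<close>,
    which puts the truncation of every point of the unit ball among the counted lattice
    points.\<close>
  define \<delta> where "\<delta> = (?D / ?A) powr (1 / \<gamma>) / F one"
  have \<delta>: "0 < \<delta>" using D A pos by (simp add: \<delta>_def)
  have \<delta>_powr: "\<delta> powr \<gamma> = ?D / ?A / F one powr \<gamma>"
    using D A pos gamma by (simp add: \<delta>_def powr_divide powr_mult powr_powr)
  \<comment> \<open>This makes \<open>x ^ n = 2 ^ (k - n)\<close>, the number of pieces per cube
    still allowed once \<open>2 ^ (n - 1)\<close> cubes are spent. From \<open>n \<le> k\<close>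
    follows \<open>1 \<le> x\<close>.\<close>
  define x where "x = 2 powr ((real k - real n) / real n)"
  have x1: "1 \<le> x" unfolding x_def using k by (intro ge_one_powr_ge_zero) auto
  define m where "m = nat \<lfloor>x\<rfloor>"
  have m: "1 \<le> m" "real m \<le> x" "x \<le> 2 * real m"
  proof -
    show "1 \<le> m" using x1 by (simp add: m_def le_nat_iff le_floor_iff)
    then have "1 \<le> real m" by simp
    moreover have "x < real m + 1" using x1 unfolding m_def by linarith
    ultimately show "x \<le> 2 * real m" by linarith
    show "real m \<le> x" using x1 unfolding m_def by linarith
  qed
  have "real m ^ n \<le> x ^ n" using m by (intro power_mono) auto
  also have "x ^ n = 2 powr (real k - real n)"
    unfolding x_def using n by (simp add: powr_realpow[symmetric] powr_powr)
  also have "\<dots> = 2 ^ (k - n)" using k by (simp add: powr_realpow[symmetric] of_nat_diff)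
  finally have mn: "m ^ n \<le> 2 ^ (k - n)" by (simp flip: of_nat_power)
  \<comment> \<open>For \<open>n \<ge> 2\<close> this follows from
    \<open>n \<le> 2 * (n - 1)\<close>. For \<open>n = 1\<close> the bound \<open>sqrt 2\<close> is
    too large, but the cardinality is an integer below 2.\<close>
  have card_L: "card F.lattice_points \<le> 2 ^ (n - 1)"
  proof (cases "n = 1")
    case True
    have "sqrt 2 < 2" by (simp add: real_less_lsqrt)
    then show ?thesis using F.card_lattice_points True by simp
  next
    case False
    have "sqrt 2 ^ n \<le> sqrt 2 ^ (2 * (n - 1))" using n False by (intro power_increasing) auto
    also have "\<dots> = 2 ^ (n - 1)" by (simp add: power_mult)
    finally have "real (card F.lattice_points) \<le> real (2 ^ (n - 1))"
      unfolding of_nat_power of_nat_numeral using F.card_lattice_points by linarith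
    then show ?thesis by (simp only: of_nat_le_iff)
  qed
  let ?J = "{1..n} \<rightarrow>\<^sub>E {..<m}"
  define centre :: "(nat \<Rightarrow> int) \<times> (nat \<Rightarrow> nat) \<Rightarrow> nat \<Rightarrow> real"
    where "centre = (\<lambda>(z, j) i. \<delta> * real_of_int (z i)
      + \<delta> * (2 * real (j i) + 1 - real m) / real m)"
  have finJ: "finite ?J" by (intro finite_PiE) auto
  have "card (centre ` (F.lattice_points \<times> ?J)) \<le> card (F.lattice_points \<times> ?J)"
    using finJ F.finite_lattice_points by (intro card_image_le) auto
  also have "\<dots> = card F.lattice_points * m ^ n"
    by (simp add: card_cartesian_product card_PiE)
  also have "\<dots> \<le> 2 ^ (n - 1) * 2 ^ (k - n)" using card_L mn by (rule mult_mono) auto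
  also have "\<dots> = 2 ^ (k - 1)" using k n by (simp flip: power_add)
  finally have card_le: "card (centre ` (F.lattice_points \<times> ?J)) \<le> 2 ^ (k - 1)" .
  have "finite (centre ` (F.lattice_points \<times> ?J))"
    using finJ F.finite_lattice_points by (intro finite_imageI finite_cartesian_product)
  from finite_subset_image_lessThan[OF this card_le]
  obtain c :: "nat \<Rightarrow> nat \<Rightarrow> real" where c: "centre ` (F.lattice_points \<times> ?J) \<subseteq> c ` {..<2 ^ (k - 1)}"
    by (elim exE)
  define \<epsilon> where "\<epsilon> = ?D powr (1 / \<gamma>) * (\<delta> / real m) * H one"
  have \<epsilon>: "0 < \<epsilon>" using D \<delta> m pos by (simp add: \<epsilon>_def)
  have "\<exists>i < 2 ^ (k - 1). H (\<lambda>j. a j - c i j) \<le> \<epsilon>" if a: "F a \<le> 1" for a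
  proof -
    have "\<exists>z :: int. \<bar>\<delta> * of_int z\<bar> \<le> \<bar>a i\<bar> \<and> \<bar>a i - \<delta> * of_int z\<bar> \<le> \<delta>" for i
      using truncation_toward_zero[OF \<delta>] by metis
    then obtain z0 :: "nat \<Rightarrow> int"
      where z0: "\<And>i. \<bar>\<delta> * of_int (z0 i)\<bar> \<le> \<bar>a i\<bar>" "\<And>i. \<bar>a i - \<delta> * of_int (z0 i)\<bar> \<le> \<delta>"
      by metis
    define z where "z = restrict z0 {1..n}"
    have "F (\<lambda>i. of_int (z i)) = F (\<lambda>i. of_int (z0 i))" by (rule F.cong) (simp add: z_def)
    moreover have "F.G (\<lambda>i. \<delta> * of_int (z0 i)) \<le> ?D * F.G a" by (rule F.solid) (rule z0)
    then have "\<delta> powr \<gamma> * F.G (\<lambda>i. of_int (z0 i)) \<le> ?D * F.G a"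
      using \<delta> by (simp add: F.G_scale)
    moreover have "F.G a \<le> 1" using F.le_iff_powr[of 1 a] a by simp
    then have "?D * F.G a \<le> ?D" using D by simp
    ultimately have "\<delta> powr \<gamma> * F.G (\<lambda>i. of_int (z i)) \<le> ?D" by simp
    then have "F.G (\<lambda>i. of_int (z i)) \<le> ?A * F.G one"
      using D A pos by (simp add: \<delta>_powr field_simps)
    then have z: "z \<in> F.lattice_points" by (auto simp: F.lattice_points_def z_def)
    have "\<exists>j<m. \<bar>(a i - \<delta> * of_int (z0 i)) - \<delta> * (2 * real j + 1 - real m) / real m\<bar> \<le> \<delta> / real m" for i
      using real_interval_subdivision[of m \<delta> "a i - \<delta> * of_int (z0 i)"] m \<delta> z0 by simp
    then obtain j0 where j0: "\<And>i. j0 i < m"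
        "\<And>i. \<bar>(a i - \<delta> * of_int (z0 i)) - \<delta> * (2 * real (j0 i) + 1 - real m) / real m\<bar> \<le> \<delta> / real m"
      by metis
    define j where "j = restrict j0 {1..n}"
    have j: "j \<in> ?J" using j0 by (auto simp: j_def)
    have "centre (z, j) \<in> c ` {..<2 ^ (k - 1)}" using z j by (intro subsetD[OF c]) auto
    then obtain i where i: "i < 2 ^ (k - 1)" "c i = centre (z, j)" by auto
    have "H.G (\<lambda>l. a l - c i l) \<le> ?D * H.G (\<lambda>l. \<delta> / real m * one l)"
    proof (rule H.solid)
      fix l assume "l \<in> {1..n}"
      then show "\<bar>a l - c i l\<bar> \<le> \<bar>\<delta> / real m * one l\<bar>"
        using j0(2)[of l] \<delta> by (simp add: i(2) centre_def z_def j_def diff_diff_eq)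
    qed
    also have "\<dots> = \<epsilon> powr \<gamma>"
      using D \<delta> m pos gamma unfolding H.G_scale by (simp add: \<epsilon>_def powr_mult powr_divide powr_powr)
    finally show ?thesis using i \<epsilon> by (auto simp: H.le_iff_powr)
  qed
  then have "\<epsilon> \<in> admissible_radii k F H" using \<epsilon> by (auto simp: admissible_radii_def)
  moreover have "\<epsilon> \<le> r"
  proof -
    have "x = 2 powr (real k / real n) / 2"
      using n by (simp add: x_def diff_divide_distrib powr_diff)
    then have "1 / real m \<le> 4 * 2 powr - (real k / real n)"
      using m by (simp add: powr_minus field_simps)
    then have "(?D powr (1 / \<gamma>) * (?D / ?A) powr (1 / \<gamma>) * (H one / F one)) * (1 / real m)
      \<le> (?D powr (1 / \<gamma>) * (?D / ?A) powr (1 / \<gamma>) * (H one / F one))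
        * (4 * 2 powr - (real k / real n))"
      using pos by (intro mult_left_mono) auto
    moreover have "upper_const \<gamma> = 4 * (?D powr (1 / \<gamma>) * (?D / ?A) powr (1 / \<gamma>))"
      by (simp add: upper_const_def power2_eq_square flip: powr_mult)
    ultimately show ?thesis by (simp add: r_def \<epsilon>_def \<delta>_def mult_ac)
  qed
  ultimately show ?thesis by blast
qed

lemma admissible_radius_lower:
  assumes k: "n \<le> k" and \<epsilon>: "\<epsilon> \<in> admissible_radii k F H"
  shows "lower_const \<gamma> * 2 powr - (real k / real n) * (H one / F one) \<le> \<epsilon>"
proof (rule ccontr)
  assume less: "\<not> ?thesis"
  let ?D = "solidity_const \<gamma>" and ?A = "lattice_const \<gamma>"
  note gamma = F.gamma and n = F.n_pos
  have D: "0 < ?D" and A: "0 < ?A"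
    using solidity_const_pos lattice_const_pos gamma by auto
  have pos: "0 < F one" "0 < H one" by (rule F.F_one_pos H.F_one_pos)+
  have \<epsilon>0: "0 < \<epsilon>" using \<epsilon> by (simp add: admissible_radii_def)
  obtain c :: "nat \<Rightarrow> nat \<Rightarrow> real" where c: "\<And>a. F a \<le> 1 \<Longrightarrow> \<exists>i < 2 ^ (k - 1). H (\<lambda>j. a j - c i j) \<le> \<epsilon>"
    using \<epsilon> by (auto simp: admissible_radii_def)
  \<comment> \<open>The radius for which solidity puts the cube of side \<open>\<rho>\<close> into
    the unit ball: \<open>?D * F.G (\<lambda>i. \<rho>) = 1\<close>.\<close>
  define \<rho> where "\<rho> = (1 / ?D) powr (1 / \<gamma>) / F one"
  have \<rho>: "0 < \<rho>" using D pos by (simp add: \<rho>_def)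
  have \<rho>_powr: "\<rho> powr \<gamma> = 1 / ?D / F one powr \<gamma>"
    using D pos gamma by (simp add: \<rho>_def powr_divide powr_mult powr_powr)
  define x where "x = 2 powr (real k / real n)"
  have x1: "1 \<le> x" unfolding x_def by (intro ge_one_powr_ge_zero) auto
  \<comment> \<open>The factor 2 gives at least \<open>2 ^ n * 2 ^ k\<close> grid points, more than
    \<open>2 ^ (k - 1)\<close> balls with \<open>sqrt 2 ^ n\<close> points each can hold.\<close>
  define m where "m = nat \<lceil>2 * x\<rceil>"
  have m: "1 \<le> m" "2 * x \<le> real m" "real m \<le> 3 * x"
    using x1 unfolding m_def by linarith+
  let ?W = "{1..n} \<rightarrow>\<^sub>E {..<m}"
  define grid where "grid w i = \<rho> / real m * real (w i)" for w and i :: nat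
  have in_ball: "F (grid w) \<le> 1" if "w \<in> ?W" for w
  proof -
    have "F.G (grid w) \<le> ?D * F.G (\<lambda>i. \<rho> * one i)"
    proof (rule F.solid)
      fix i assume "i \<in> {1..n}"
      then have "real (w i) \<le> real m" using that by (auto simp: PiE_iff less_imp_le)
      then show "\<bar>grid w i\<bar> \<le> \<bar>\<rho> * one i\<bar>"
        using \<rho> m by (simp add: grid_def field_simps)
    qed
    also have "\<dots> = 1" using \<rho> D pos unfolding F.G_scale by (simp add: \<rho>_powr)
    finally show ?thesis using F.le_iff_powr[of 1] by simp
  qed
  have "\<exists>i. w \<in> ?W \<longrightarrow> i < 2 ^ (k - 1) \<and> H (\<lambda>j. grid w j - c i j) \<le> \<epsilon>" for w
    using c[OF in_ball] by blast
  then obtain \<iota> :: "(nat \<Rightarrow> nat) \<Rightarrow> nat" where \<iota>: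
      "\<And>w. w \<in> ?W \<Longrightarrow> \<iota> w < 2 ^ (k - 1) \<and> H (\<lambda>j. grid w j - c (\<iota> w) j) \<le> \<epsilon>"
    by metis
  \<comment> \<open>The assumed smallness of \<open>\<epsilon>\<close>, combined with
    \<open>m \<le> 3 * x\<close>. The factor 2 leaves room for the difference of two points of one
    ball.\<close>
  have \<epsilon>_powr: "2 * \<epsilon> powr \<gamma> \<le> (\<rho> / real m) powr \<gamma> * (?A * H.G one)"
  proof -
    have "\<epsilon> \<le> lower_const \<gamma> * 2 powr - (real k / real n) * (H one / F one)" using less by simp
    also have "\<dots> = (?A / (2 * ?D)) powr (1 / \<gamma>) * (H one / F one) / (3 * x)"
      by (simp add: lower_const_def x_def powr_minus field_simps)
    also have "\<dots> \<le> (?A / (2 * ?D)) powr (1 / \<gamma>) * (H one / F one) / real m"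
      using m pos by (intro divide_left_mono) auto
    finally have "\<epsilon> powr \<gamma> \<le> ((?A / (2 * ?D)) powr (1 / \<gamma>) * (H one / F one) / real m) powr \<gamma>"
      using \<epsilon>0 gamma by (intro powr_mono2) auto
    also have "\<dots> = ?A / (2 * ?D) * (H.G one / F.G one) / real m powr \<gamma>"
      using A D gamma pos by (simp add: powr_mult powr_divide powr_powr)
    also have "\<dots> = (\<rho> / real m) powr \<gamma> * (?A * H.G one) / 2"
      by (simp add: powr_divide \<rho>_powr)
    finally show ?thesis by simp
  qed
  have fibre: "real (card {w \<in> ?W. \<iota> w = l}) \<le> sqrt 2 ^ n" for l
  proof (cases "{w \<in> ?W. \<iota> w = l} = {}")
    case True
    then show ?thesis by (simp only: card.empty) simp
  next
    case False
    \<comment> \<open>Subtracting one fixed grid point of the ball removes the unknown centre and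
      maps the fibre injectively into the lattice points of \<open>H\<close>.\<close>
    then obtain w0 where w0: "w0 \<in> ?W" "\<iota> w0 = l" by blast
    define shift where "shift w = restrict (\<lambda>i. int (w i) - int (w0 i)) {1..n}" for w :: "nat \<Rightarrow> nat"
    have "inj_on shift {w \<in> ?W. \<iota> w = l}"
    proof (rule inj_onI)
      fix w w' assume *: "w \<in> {w \<in> ?W. \<iota> w = l}" "w' \<in> {w \<in> ?W. \<iota> w = l}" "shift w = shift w'"
      then have w: "w \<in> ?W" "w' \<in> ?W" by auto
      show "w = w'"
      proof (rule PiE_ext[OF w])
        fix i assume "i \<in> {1..n}"
        then show "w i = w' i" using fun_cong[OF *(3), of i] by (simp add: shift_def)
      qed
    qed
    moreover have "shift ` {w \<in> ?W. \<iota> w = l} \<subseteq> H.lattice_points"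
    proof safe
      fix w assume w: "w \<in> ?W" "l = \<iota> w"
      let ?z = "\<lambda>i. real_of_int (shift w i)"
      have "(\<rho> / real m) powr \<gamma> * H.G ?z = H.G (\<lambda>i. \<rho> / real m * ?z i)"
        using \<rho> unfolding H.G_scale by simp
      also have "H (\<lambda>i. \<rho> / real m * ?z i) = H (\<lambda>i. (grid w i - c l i) - (grid w0 i - c l i))"
        by (rule H.cong) (simp add: shift_def grid_def algebra_simps diff_divide_distrib)
      also have "H.G (\<lambda>i. (grid w i - c l i) - (grid w0 i - c l i))
          \<le> H.G (\<lambda>i. grid w i - c l i) + H.G (\<lambda>i. grid w0 i - c l i)" by (rule H.G_diff)
      also have "\<dots> \<le> \<epsilon> powr \<gamma> + \<epsilon> powr \<gamma>"
        using \<iota>[OF w(1)] \<iota>[OF w0(1)] w w0 \<epsilon>0 by (intro add_mono) (auto simp flip: H.le_iff_powr)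
      also have "\<dots> \<le> (\<rho> / real m) powr \<gamma> * (?A * H.G one)" using \<epsilon>_powr by simp
      finally have "H.G ?z \<le> ?A * H.G one" using \<rho> m by simp
      then show "shift w \<in> H.lattice_points" by (auto simp: H.lattice_points_def shift_def)
    qed
    ultimately have "card {w \<in> ?W. \<iota> w = l} \<le> card H.lattice_points"
      using H.finite_lattice_points by (rule card_inj_on_le)
    then show ?thesis using H.card_lattice_points by linarith
  qed
  have finW: "finite ?W" by (intro finite_PiE) auto
  have "2 ^ n * 2 ^ k = (2 * x) ^ n"
    using n by (simp add: x_def power_mult_distrib powr_realpow[symmetric] powr_powr)
  also have "\<dots> \<le> real m ^ n" using m x1 by (intro power_mono) auto
  also have "\<dots> = real (card ?W)" by (simp add: card_PiE)
  also have "?W = (\<Union>l<2 ^ (k - 1). {w \<in> ?W. \<iota> w = l})" using \<iota> by auto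
  also have "real (card \<dots>) \<le> real (\<Sum>l<2 ^ (k - 1). card {w \<in> ?W. \<iota> w = l})"
    by (intro of_nat_mono card_UN_le) simp
  also have "\<dots> \<le> (\<Sum>l<(2::nat) ^ (k - 1). sqrt 2 ^ n)"
    unfolding of_nat_sum by (intro sum_mono fibre)
  also have "\<dots> = 2 ^ (k - 1) * sqrt 2 ^ n" by simp
  also have "\<dots> < 2 ^ k * 2 ^ n"
  proof (rule mult_strict_mono)
    show "(2::real) ^ (k - 1) < 2 ^ k" using k n by (intro power_strict_increasing) auto
    show "sqrt 2 ^ n < 2 ^ n" using n by (intro power_strict_mono) (auto simp: real_less_lsqrt)
  qed auto
  finally show False by simp
qed

text \<open>The radius from the upper bound also shows that the set is nonempty, as the lower bound
  for its infimum requires.\<close>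

lemma Inf_admissible_radii:
  assumes "n \<le> k"
  shows "lower_const \<gamma> * 2 powr - (real k / real n) * (H one / F one) \<le> Inf (admissible_radii k F H)"
    and "Inf (admissible_radii k F H) \<le> upper_const \<gamma> * 2 powr - (real k / real n) * (H one / F one)"
proof -
  obtain \<epsilon> where \<epsilon>: "\<epsilon> \<in> admissible_radii k F H"
      "\<epsilon> \<le> upper_const \<gamma> * 2 powr - (real k / real n) * (H one / F one)"
    using admissible_radius_upper[OF assms] by blast
  show "lower_const \<gamma> * 2 powr - (real k / real n) * (H one / F one) \<le> Inf (admissible_radii k F H)"
    using \<epsilon>(1) admissible_radius_lower[OF assms] by (intro cInf_greatest) auto
  have "bdd_below (admissible_radii k F H)"
    by (rule bdd_belowI[of _ 0]) (auto simp: admissible_radii_def)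
  then show "Inf (admissible_radii k F H) \<le> upper_const \<gamma> * 2 powr - (real k / real n) * (H one / F one)"
    using cInf_lower[OF \<epsilon>(1)] \<epsilon>(2) by linarith
qed

end

subsection \<open>From spaces to coefficients\<close>

definition coeff_norm :: "nat \<Rightarrow> ('a::real_vector \<Rightarrow> real) \<Rightarrow> (nat \<Rightarrow> 'a) \<Rightarrow> (nat \<Rightarrow> real) \<Rightarrow> real" where
  "coeff_norm n N x a = N (\<Sum>i=1..n. a i *\<^sub>R x i)"

lemma fundamental_eq_coeff_norm: "fundamental N x n = coeff_norm n N x (\<lambda>_. 1)"
  by (simp add: fundamental_def coeff_norm_def)

lemma is_basis_image:
  assumes "is_basis n X x"
  shows "X = range (\<lambda>a. \<Sum>i=1..n. a i *\<^sub>R x i)"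
proof -
  have inj: "inj_on x {1..n}" and X: "X = span (x ` {1..n})"
    using assms by (auto simp: is_basis_def)
  have "X = range (\<lambda>u. \<Sum>v\<in>x ` {1..n}. u v *\<^sub>R v)"
    unfolding X by (rule span_finite) simp
  also have "\<dots> = range (\<lambda>u. \<Sum>i=1..n. u (x i) *\<^sub>R x i)"
    unfolding sum.reindex[OF inj] o_def ..
  also have "\<dots> \<subseteq> range (\<lambda>a. \<Sum>i=1..n. a i *\<^sub>R x i)"
    by (rule image_subsetI) (rule range_eqI[where x="\<lambda>i. _ (x i)"], rule refl)
  finally have "X \<subseteq> range (\<lambda>a. \<Sum>i=1..n. a i *\<^sub>R x i)" .
  moreover have "range (\<lambda>a. \<Sum>i=1..n. a i *\<^sub>R x i) \<subseteq> X"
    unfolding X by (intro image_subsetI span_sum span_scale span_base imageI)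
  ultimately show ?thesis by (rule equalityI)
qed

lemma symmetric_functional_coeff_norm:
  assumes "0 < \<gamma>" "\<gamma> \<le> 1" "1 \<le> n" "gamma_banach \<gamma> X N" "symmetric_basis n X N x" "normalised n N x"
  shows "symmetric_functional \<gamma> n (coeff_norm n N x)"
proof
  have "is_basis n X x" using assms by (simp add: symmetric_basis_def)
  then have X: "(\<Sum>i=1..n. a i *\<^sub>R x i) \<in> X" for a by (auto dest: is_basis_image)
  have N: "gamma_norm_on \<gamma> X N" using assms by (simp add: gamma_banach_def)
  show "coeff_norm n N x a = coeff_norm n N x b" if "\<And>i. i \<in> {1..n} \<Longrightarrow> a i = b i" for a b
    unfolding coeff_norm_def using that by (intro arg_cong[where f=N] sum.cong) auto
  show "0 \<le> coeff_norm n N x a" for a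
    using N X by (auto simp: coeff_norm_def gamma_norm_on_def)
  show "coeff_norm n N x (\<lambda>i. c * a i) = \<bar>c\<bar> * coeff_norm n N x a" for c a
  proof -
    have "(\<Sum>i=1..n. (c * a i) *\<^sub>R x i) = c *\<^sub>R (\<Sum>i=1..n. a i *\<^sub>R x i)"
      by (simp add: scaleR_sum_right)
    then show ?thesis using N X by (auto simp: coeff_norm_def gamma_norm_on_def)
  qed
  show "coeff_norm n N x (\<lambda>i. a i + b i) powr \<gamma> \<le> coeff_norm n N x a powr \<gamma> + coeff_norm n N x b powr \<gamma>"
    for a b
    using N X by (auto simp: coeff_norm_def gamma_norm_on_def scaleR_add_left sum.distrib)
  show "coeff_norm n N x a = coeff_norm n N x (\<lambda>i. \<epsilon> i * a (\<pi> i))"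
    if "\<pi> permutes {1..n}" "\<And>i. i \<in> {1..n} \<Longrightarrow> \<epsilon> i \<in> {1, -1}" for \<pi> \<epsilon> a
    using assms(5) that by (simp add: coeff_norm_def symmetric_basis_def)
  show "coeff_norm n N x (indicator {i}) = 1" if i: "i \<in> {1..n}" for i
  proof -
    have "(\<Sum>j=1..n. indicator {i} j *\<^sub>R x j) = (\<Sum>j=1..n. if j = i then x j else 0)"
      by (intro sum.cong) (auto simp: indicator_def)
    also have "\<dots> = x i" using i by simp
    finally show ?thesis using assms(6) i by (simp add: coeff_norm_def normalised_def)
  qed
qed (use assms in auto)

text \<open>Points and centres are all combinations of basis vectors, so the entropy number depends
  on the two coefficient norms alone. This reduces the estimate to coefficients and also makes it
  independent of the ambient types.\<close>

lemma entropy_number_eq_Inf: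
  assumes X_basis: "is_basis n X x" and Y_basis: "is_basis n Y y" and M: "gamma_norm_on \<gamma> Y M"
  shows "entropy_number k X N Y M (natural_embedding n x y)
    = Inf (admissible_radii k (coeff_norm n N x) (coeff_norm n M y))"
proof -
  let ?x = "\<lambda>a. \<Sum>i=1..n. a i *\<^sub>R x i" and ?y = "\<lambda>a. \<Sum>i=1..n. a i *\<^sub>R y i"
  let ?T = "natural_embedding n x y"
  have X: "X = range ?x" and Y: "Y = range ?y" by (rule is_basis_image[OF X_basis] is_basis_image[OF Y_basis])+
  have T: "?T (?x a) = ?y a" for a by (rule natural_embedding_sum[OF X_basis])
  have y_diff: "?y (\<lambda>j. a j - b j) = ?y a - ?y b" for a b :: "nat \<Rightarrow> real"
    by (simp add: scaleR_diff_left sum_subtractf)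
  have "unit_ball X N = ?x ` {a. coeff_norm n N x a \<le> 1}"
    unfolding unit_ball_def X coeff_norm_def by blast
  then have image_ball: "?T ` unit_ball X N = ?y ` {a. coeff_norm n N x a \<le> 1}"
    by (simp only: image_image T)
  have ball: "?y a \<in> (\<lambda>v. ?y b + \<epsilon> *\<^sub>R v) ` unit_ball Y M \<longleftrightarrow> coeff_norm n M y (\<lambda>j. a j - b j) \<le> \<epsilon>"
    if \<epsilon>: "0 < \<epsilon>" for a b \<epsilon>
  proof
    assume "?y a \<in> (\<lambda>v. ?y b + \<epsilon> *\<^sub>R v) ` unit_ball Y M"
    then obtain v where v: "v \<in> Y" "M v \<le> 1" "?y (\<lambda>j. a j - b j) = \<epsilon> *\<^sub>R v"
      unfolding y_diff by (auto simp: unit_ball_def)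
    then have "M (?y (\<lambda>j. a j - b j)) = \<epsilon> * M v" using M \<epsilon> by (simp add: gamma_norm_on_def)
    then show "coeff_norm n M y (\<lambda>j. a j - b j) \<le> \<epsilon>"
      using v \<epsilon> by (simp add: coeff_norm_def)
  next
    assume le: "coeff_norm n M y (\<lambda>j. a j - b j) \<le> \<epsilon>"
    define u where "u = ?y (\<lambda>j. a j - b j)"
    have u: "u \<in> Y" unfolding u_def Y by (rule rangeI)
    define v where "v = ?y (\<lambda>j. (1 / \<epsilon>) * (a j - b j))"
    have v: "v = (1 / \<epsilon>) *\<^sub>R u" by (simp add: u_def v_def scaleR_sum_right)
    have "M ((1 / \<epsilon>) *\<^sub>R u) = \<bar>1 / \<epsilon>\<bar> * M u" using M u unfolding gamma_norm_on_def by blast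
    then have "M v = M u / \<epsilon>" using \<epsilon> by (simp add: v)
    moreover have "M u \<le> \<epsilon>" using le by (simp add: coeff_norm_def u_def)
    ultimately have "M v \<le> 1" using \<epsilon> by simp
    moreover have "v \<in> Y" unfolding v_def Y by (rule rangeI)
    moreover have "?y a = ?y b + \<epsilon> *\<^sub>R v"
    proof -
      have "\<epsilon> *\<^sub>R v = ?y a - ?y b" using \<epsilon> y_diff[of a b] by (simp add: v u_def)
      then show ?thesis by simp
    qed
    ultimately show "?y a \<in> (\<lambda>v. ?y b + \<epsilon> *\<^sub>R v) ` unit_ball Y M"
      unfolding unit_ball_def by blast
  qed
  have "(\<exists>c :: nat \<Rightarrow> _. (\<forall>i < 2 ^ (k - 1). c i \<in> Y) \<and>
       ?T ` unit_ball X N \<subseteq> (\<Union>i < 2 ^ (k - 1). (\<lambda>v. c i + \<epsilon> *\<^sub>R v) ` unit_ball Y M))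
    \<longleftrightarrow> (\<exists>c :: nat \<Rightarrow> nat \<Rightarrow> real. \<forall>a. coeff_norm n N x a \<le> 1 \<longrightarrow>
       (\<exists>i < 2 ^ (k - 1). coeff_norm n M y (\<lambda>j. a j - c i j) \<le> \<epsilon>))"
    (is "?L \<longleftrightarrow> ?R") if \<epsilon>: "0 < \<epsilon>" for \<epsilon>
  proof
    assume ?L
    then obtain c :: "nat \<Rightarrow> _" where c: "\<And>i. i < 2 ^ (k - 1) \<Longrightarrow> c i \<in> Y"
      "?T ` unit_ball X N \<subseteq> (\<Union>i < 2 ^ (k - 1). (\<lambda>v. c i + \<epsilon> *\<^sub>R v) ` unit_ball Y M)" by blast
    \<comment> \<open>Centres are known to lie in \<open>Y\<close> only below
      \<open>2 ^ (k - 1)\<close>, so coefficients are chosen under that condition.\<close>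
    from c(1) have "\<exists>b. i < 2 ^ (k - 1) \<longrightarrow> c i = ?y b" for i unfolding Y by blast
    then obtain b where b: "\<And>i. i < 2 ^ (k - 1) \<Longrightarrow> c i = ?y (b i)" by metis
    have "\<exists>i < 2 ^ (k - 1). coeff_norm n M y (\<lambda>j. a j - b i j) \<le> \<epsilon>" if "coeff_norm n N x a \<le> 1" for a
    proof -
      have "?y a \<in> ?T ` unit_ball X N" unfolding image_ball using that by blast
      then obtain i where i: "i < 2 ^ (k - 1)" "?y a \<in> (\<lambda>v. c i + \<epsilon> *\<^sub>R v) ` unit_ball Y M"
        using c(2) by blast
      then show ?thesis using ball[OF \<epsilon>] unfolding b[OF i(1)] by blast
    qed
    then show ?R by blast
  next
    assume ?R
    then obtain b :: "nat \<Rightarrow> nat \<Rightarrow> real" where b: "\<And>a. coeff_norm n N x a \<le> 1 \<Longrightarrow>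
       \<exists>i < 2 ^ (k - 1). coeff_norm n M y (\<lambda>j. a j - b i j) \<le> \<epsilon>" by blast
    have "?T ` unit_ball X N \<subseteq> (\<Union>i < 2 ^ (k - 1). (\<lambda>v. ?y (b i) + \<epsilon> *\<^sub>R v) ` unit_ball Y M)"
    proof
      fix w assume "w \<in> ?T ` unit_ball X N"
      then obtain a where a: "w = ?y a" "coeff_norm n N x a \<le> 1" unfolding image_ball by blast
      from b[OF a(2)] show "w \<in> (\<Union>i < 2 ^ (k - 1). (\<lambda>v. ?y (b i) + \<epsilon> *\<^sub>R v) ` unit_ball Y M)"
        unfolding a(1) using ball[OF \<epsilon>] by blast
    qed
    moreover have "\<forall>i < (2::nat) ^ (k - 1). ?y (b i) \<in> Y" unfolding Y by blast
    ultimately show ?L by (intro exI[of _ "\<lambda>i. ?y (b i)"] conjI)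
  qed
  then show ?thesis
    unfolding entropy_number_def admissible_radii_def
    by (intro arg_cong[where f=Inf] Collect_cong) blast
qed

lemma entropy_estimate_all:
  assumes "0 < \<gamma>" "\<gamma> \<le> 1"
  shows "entropy_estimate TYPE('a::real_vector) TYPE('b::real_vector) \<gamma> (lower_const \<gamma>) (upper_const \<gamma>)"
  unfolding entropy_estimate_def
proof (intro allI impI)
  fix n k :: nat and X :: "'a set" and N x and Y :: "'b set" and M y
  assume a: "1 \<le> n" "gamma_banach \<gamma> X N" "symmetric_basis n X N x" "normalised n N x"
    "gamma_banach \<gamma> Y M" "symmetric_basis n Y M y" "normalised n M y" "n \<le> k"
  interpret symmetric_functional_pair \<gamma> n "coeff_norm n N x" "coeff_norm n M y"
    unfolding symmetric_functional_pair_def using a assms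
    by (blast intro: symmetric_functional_coeff_norm)
  have "entropy_number k X N Y M (natural_embedding n x y)
    = Inf (admissible_radii k (coeff_norm n N x) (coeff_norm n M y))"
    using a by (intro entropy_number_eq_Inf) (auto simp: symmetric_basis_def gamma_banach_def)
  then show "lower_const \<gamma> * 2 powr - (real k / real n) * (fundamental M y n / fundamental N x n)
      \<le> entropy_number k X N Y M (natural_embedding n x y) \<and>
    entropy_number k X N Y M (natural_embedding n x y)
      \<le> upper_const \<gamma> * 2 powr - (real k / real n) * (fundamental M y n / fundamental N x n)"
    using Inf_admissible_radii[OF a(8)] by (simp add: fundamental_eq_coeff_norm)
qed

section \<open>Isometric copies in the universal type\<close>

lemma gamma_banach_pullback:
  assumes T: "linear T" "inj_on T X'" "T ` X' = X" and X': "subspace X'" and X: "gamma_banach \<gamma> X N"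
  shows "gamma_banach \<gamma> X' (N \<circ> T)"
  unfolding gamma_banach_def
proof (intro conjI X')
  have N: "gamma_norm_on \<gamma> X N" and complete: "complete_wrt X N"
    using X by (auto simp: gamma_banach_def)
  have mem: "T v \<in> X" if "v \<in> X'" for v using T that by auto
  have T0: "T v = 0 \<longleftrightarrow> v = 0" if "v \<in> X'" for v
    using T that inj_onD[OF T(2), of v 0] subspace_0[OF X'] linear_0[OF T(1)] by auto
  show "gamma_norm_on \<gamma> X' (N \<circ> T)"
    using N mem T0 unfolding gamma_norm_on_def
    by (auto simp: linear_add[OF T(1)] linear_scale[OF T(1)])
  show "complete_wrt X' (N \<circ> T)"
    unfolding complete_wrt_def
  proof (intro allI impI)
    fix s :: "nat \<Rightarrow> 'a"
    assume s: "range s \<subseteq> X'"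
      and cauchy: "\<forall>\<epsilon>>0. \<exists>m0. \<forall>m\<ge>m0. \<forall>l\<ge>m0. (N \<circ> T) (s m - s l) < \<epsilon>"
    have "range (T \<circ> s) \<subseteq> X" using s mem by auto
    moreover have "\<forall>\<epsilon>>0. \<exists>m0. \<forall>m\<ge>m0. \<forall>l\<ge>m0. N ((T \<circ> s) m - (T \<circ> s) l) < \<epsilon>"
      using cauchy by (simp add: linear_diff[OF T(1)])
    ultimately obtain w where w: "w \<in> X" "(\<lambda>m. N ((T \<circ> s) m - w)) \<longlonglongrightarrow> 0"
      using complete unfolding complete_wrt_def by blast
    then obtain v where v: "v \<in> X'" "w = T v" using T(3) by blast
    then show "\<exists>v\<in>X'. (\<lambda>m. (N \<circ> T) (s m - v)) \<longlonglongrightarrow> 0"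
      using w by (auto simp: linear_diff[OF T(1)])
  qed
qed

text \<open>A nontrivial relation in \<open>B\<close> is mapped to one in the image; injectivity on
  \<open>B\<close> keeps its terms from merging.\<close>

lemma independent_of_independent_image:
  assumes T: "linear T" "inj_on T B" and B: "independent (T ` B)" "finite B"
  shows "independent B"
proof
  assume "dependent B"
  then obtain u v where u: "v \<in> B" "u v \<noteq> 0" "(\<Sum>v\<in>B. u v *\<^sub>R v) = 0"
    using dependent_finite[OF B(2)] by blast
  let ?u = "u \<circ> inv_into B T"
  have "(\<Sum>w\<in>T ` B. ?u w *\<^sub>R w) = (\<Sum>v\<in>B. u v *\<^sub>R T v)"
    using T(2) by (simp add: sum.reindex)
  also have "\<dots> = T (\<Sum>v\<in>B. u v *\<^sub>R v)"
    by (simp add: linear_sum[OF T(1)] linear_scale[OF T(1)])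
  finally have "(\<Sum>w\<in>T ` B. ?u w *\<^sub>R w) = 0" using u(3) linear_0[OF T(1)] by simp
  moreover have "?u (T v) \<noteq> 0" using T(2) u by simp
  ultimately have "dependent (T ` B)"
    using dependent_finite[of "T ` B"] B(2) u(1) by blast
  then show False using B(1) by simp
qed

text \<open>The copy is spanned by the first unit sequences and normed through the map
  \<open>T\<close> to \<open>X\<close>. Equality of the coefficient norms is what carries entropy
  numbers and fundamental functions over.\<close>

lemma universal_copy:
  fixes X :: "'a::real_vector set"
  assumes X: "gamma_banach \<gamma> X N" "symmetric_basis n X N x" "normalised n N x"
  obtains X' :: "universal set" and N' x' where
    "gamma_banach \<gamma> X' N'" "dim X' = n" "symmetric_basis n X' N' x'" "normalised n N' x'"
    "coeff_norm n N' x' = coeff_norm n N x"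
proof -
  define T :: "universal \<Rightarrow> 'a" where "T v = (\<Sum>i=1..n. Poly_Mapping.lookup v i *\<^sub>R x i)" for v
  define x' :: "nat \<Rightarrow> universal" where "x' i = Poly_Mapping.single i 1" for i
  define X' where "X' = span (x' ` {1..n})"
  define N' where "N' = N \<circ> T"
  have inj: "inj_on x {1..n}" and ind: "independent (x ` {1..n})" and span: "span (x ` {1..n}) = X"
    using X by (auto simp: symmetric_basis_def is_basis_def)
  have lookup_scaleR: "Poly_Mapping.lookup (c *\<^sub>R v) i = c * Poly_Mapping.lookup v i" for c i and v :: universal
  proof -
    have "finite {j. c *\<^sub>R Poly_Mapping.lookup v j \<noteq> 0}"
      by (rule finite_subset[OF _ finite_lookup[of v]]) auto
    then show ?thesis by (simp add: scaleR_poly_mapping_def Abs_poly_mapping_inverse)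
  qed
  have T: "linear T"
    by (rule linearI)
      (simp_all add: T_def lookup_add lookup_scaleR scaleR_add_left sum.distrib scaleR_sum_right)
  have Tx': "T (x' i) = x i" if "i \<in> {1..n}" for i
  proof -
    have "T (x' i) = (\<Sum>j=1..n. if j = i then x j else 0)"
      unfolding T_def x'_def by (intro sum.cong) (auto simp: lookup_single when_def)
    then show ?thesis using that by simp
  qed
  have image: "T ` x' ` {1..n} = x ` {1..n}"
    unfolding image_image by (rule image_cong[OF refl Tx'])
  have "inj_on (T \<circ> x') {1..n} \<longleftrightarrow> inj_on x {1..n}"
    by (rule inj_on_cong) (simp only: o_apply Tx')
  then have inj_comp: "inj_on (T \<circ> x') {1..n}" using inj by blast
  have inj': "inj_on x' {1..n}" by (rule inj_on_imageI2[OF inj_comp])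
  have inj_T: "inj_on T (x' ` {1..n})" by (rule inj_on_imageI[OF inj_comp])
  \<comment> \<open>On the whole type \<open>T\<close> kills every unit sequence with index outside
    \<open>{1..n}\<close>, so injectivity is claimed only on the span.\<close>
  have inj_TX': "inj_on T X'"
    unfolding X'_def using ind[folded image] by (rule linear_inj_on_span_independent_image[OF T _ inj_T])
  have ind': "independent (x' ` {1..n})"
    using ind[folded image] by (intro independent_of_independent_image[OF T inj_T]) simp_all
  have basis': "is_basis n X' x'" unfolding is_basis_def X'_def using inj' ind' by simp
  have sum: "T (\<Sum>i=1..n. a i *\<^sub>R x' i) = (\<Sum>i=1..n. a i *\<^sub>R x i)" for a
    by (simp add: linear_sum[OF T] linear_scale[OF T] Tx' del: atLeastAtMost_iff One_nat_def)
  show thesis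
  proof
    show "gamma_banach \<gamma> X' N'" unfolding N'_def
    proof (rule gamma_banach_pullback[OF T inj_TX' _ _ X(1)])
      show "T ` X' = X" unfolding X'_def by (simp only: linear_span_image[OF T, symmetric] image span)
    qed (simp add: X'_def)
    show "dim X' = n" unfolding X'_def
      using dim_span_eq_card_independent[OF ind'] card_image[OF inj'] by simp
    show "symmetric_basis n X' N' x'"
      using X(2) basis' unfolding symmetric_basis_def N'_def o_def sum by blast
    show "normalised n N' x'" using X(3) by (simp add: normalised_def N'_def Tx' del: atLeastAtMost_iff One_nat_def)
    show "coeff_norm n N' x' = coeff_norm n N x"
      by (rule ext) (simp only: coeff_norm_def N'_def o_apply sum)
  qed
qed

text \<open>Both spaces are replaced by their copies; all quantities in the estimate are functions
  of the coefficient norms and stay the same.\<close>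

lemma entropy_estimate_transfer:
  assumes est: "entropy_estimate TYPE(universal) TYPE(universal) \<gamma> c1 c2"
  shows "entropy_estimate TYPE('a::real_vector) TYPE('b::real_vector) \<gamma> c1 c2"
  unfolding entropy_estimate_def
proof (intro allI impI)
  fix n k :: nat and X :: "'a set" and N x and Y :: "'b set" and M y
  assume a: "1 \<le> n" "gamma_banach \<gamma> X N" "symmetric_basis n X N x" "normalised n N x"
    "gamma_banach \<gamma> Y M" "symmetric_basis n Y M y" "normalised n M y" "n \<le> k"
  obtain X' :: "universal set" and N' x' where X':
    "gamma_banach \<gamma> X' N'" "dim X' = n" "symmetric_basis n X' N' x'" "normalised n N' x'"
    "coeff_norm n N' x' = coeff_norm n N x"
    by (rule universal_copy[OF a(2-4)])
  obtain Y' :: "universal set" and M' y' where Y':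
    "gamma_banach \<gamma> Y' M'" "dim Y' = n" "symmetric_basis n Y' M' y'" "normalised n M' y'"
    "coeff_norm n M' y' = coeff_norm n M y"
    by (rule universal_copy[OF a(5-7)])
  have "entropy_number k X N Y M (natural_embedding n x y)
    = Inf (admissible_radii k (coeff_norm n N x) (coeff_norm n M y))"
    using a by (intro entropy_number_eq_Inf) (auto simp: symmetric_basis_def gamma_banach_def)
  also have "\<dots> = entropy_number k X' N' Y' M' (natural_embedding n x' y')"
    unfolding X'(5)[symmetric] Y'(5)[symmetric] using X' Y'
    by (intro entropy_number_eq_Inf[symmetric]) (auto simp: symmetric_basis_def gamma_banach_def)
  finally have e: "entropy_number k X N Y M (natural_embedding n x y)
    = entropy_number k X' N' Y' M' (natural_embedding n x' y')" .
  have f: "fundamental N x n = fundamental N' x' n" "fundamental M y n = fundamental M' y' n"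
    by (simp_all only: fundamental_eq_coeff_norm X'(5) Y'(5))
  show "c1 * 2 powr - (real k / real n) * (fundamental M y n / fundamental N x n)
      \<le> entropy_number k X N Y M (natural_embedding n x y) \<and>
    entropy_number k X N Y M (natural_embedding n x y)
      \<le> c2 * 2 powr - (real k / real n) * (fundamental M y n / fundamental N x n)"
    unfolding e f using est a(1,8) X'(1-4) Y'(1-4) unfolding entropy_estimate_def by blast
qed

theorem theorem18:
  fixes \<gamma> :: real
  assumes "0 < \<gamma>" and "\<gamma> \<le> 1"
  shows "(\<exists>c1>0. \<exists>c2>0. entropy_estimate TYPE(universal) TYPE(universal) \<gamma> c1 c2) \<and>
    (\<forall>c1 c2. entropy_estimate TYPE(universal) TYPE(universal) \<gamma> c1 c2 \<longrightarrow>
       entropy_estimate TYPE('a::real_vector) TYPE('b::real_vector) \<gamma> c1 c2)"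
proof (intro conjI allI impI)
  have "0 < lower_const \<gamma>" "0 < upper_const \<gamma>"
    using solidity_const_pos[OF assms(1)] lattice_const_pos[OF assms(1)]
    by (auto simp: lower_const_def upper_const_def)
  then show "\<exists>c1>0. \<exists>c2>0. entropy_estimate TYPE(universal) TYPE(universal) \<gamma> c1 c2"
    using entropy_estimate_all[OF assms] by blast
qed (rule entropy_estimate_transfer)

end
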